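(* Let $s,t\ge 0$ be integers, let $r\in\mathbb{Z}$, and let $N_r=\begin{pmatrix}s^2&r\\0&t^2\end{pmatrix}$. Then $N_r$ admits infinitely many Jordan $D(N_r)$-quadruples in $UT_2(\mathbb{Z})$.
   Context: $UT_2(\mathbb{Z})$ denotes the ring of upper-triangular $2\times 2$ integer matrices, and $A\circ B=\frac12(AB+BA)$ (computed over $\mathbb{Q}$) is the Jordan product. For $N\in UT_2(\mathbb{Z})$, a Jordan $D(N)$-quadruple in $UT_2(\mathbb{Z})$ is a set of four distinct nonzero matrices $A_1,A_2,A_3,A_4\in UT_2(\mathbb{Z})$ such that for every $1\le i<j\le 4$ there exists $X_{ij}\in UT_2(\mathbb{Z})$ with $A_i\circ A_j+N=X_{ij}^2$. *)

theory Defs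
  imports "HOL-Analysis.Analysis"
begin

definition UT2 :: "(int ^ 2 ^ 2) set" where
  "UT2 = {A. A $ 2 $ 1 = 0}"

definition rat_matrix :: "int ^ 'n ^ 'm \<Rightarrow> rat ^ 'n ^ 'm" where
  "rat_matrix A = (\<chi> i j. rat_of_int (A $ i $ j))"

definition jordan_product :: "rat ^ 'n ^ 'n \<Rightarrow> rat ^ 'n ^ 'n \<Rightarrow> rat ^ 'n ^ 'n" where
  "jordan_product A B = (\<chi> i j. (1 / 2) * (A ** B + B ** A) $ i $ j)"

text \<open>Quadruples are sets, so the order of the entries does not matter; since the Jordan product
  is commutative, ranging over all pairs of distinct elements is the same as ranging over the
  pairs of indices \<open>i < j\<close> in an enumeration. The equation is required over the rationals,
  because the Jordan product of two integer matrices need not have integer entries.\<close>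

definition jordan_D_quadruple :: "int ^ 2 ^ 2 \<Rightarrow> (int ^ 2 ^ 2) set \<Rightarrow> bool" where
  "jordan_D_quadruple N S \<longleftrightarrow>
     S \<subseteq> UT2 \<and> card S = 4 \<and> 0 \<notin> S \<and>
     (\<forall>A\<in>S. \<forall>B\<in>S. A \<noteq> B \<longrightarrow>
        (\<exists>X\<in>UT2. jordan_product (rat_matrix A) (rat_matrix B) + rat_matrix N
                  = rat_matrix (X ** X)))"

end

theory Submission
  imports Defs
begin

text \<open>
  Write an upper triangular matrix as \<open>(a, b; c)\<close>, with diagonal \<open>a, c\<close> and corner \<open>b\<close>. With all
  corners even, say \<open>2 * \<beta>\<close>, the condition on two matrices \<open>(a, 2\<beta>; c)\<close> and \<open>(a', 2\<beta>'; c')\<close> is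
  that there are integers \<open>x, y, z\<close> with
  \<open>a a' + s\<^sup>2 = x\<^sup>2\<close>, \<open>c c' + t\<^sup>2 = z\<^sup>2\<close> and
  \<open>(a + c) \<beta>' + (a' + c') \<beta> + r = y (x + z)\<close>.
  So the diagonals form two Diophantine problems, and the corners have to satisfy one linear
  congruence modulo \<open>x + z\<close> for each pair, where the signs of \<open>x\<close> and \<open>z\<close> may be chosen freely.

  The quadruple consists of \<open>(1, 2\<beta>; 0)\<close>, \<open>(q, 2\<beta>\<^sub>2; 0)\<close>, \<open>(0, 2\<beta>\<^sub>3; 1)\<close>, \<open>(0, 2\<beta>\<^sub>4; v)\<close> with
  \<open>q = (t - 1)\<^sup>2 - s\<^sup>2\<close> and \<open>v = (s + 1)\<^sup>2 - t\<^sup>2\<close>. These values make \<open>x + z = -1\<close> possible for the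
  first two matrices (\<open>x = t - 1\<close>, \<open>z = -t\<close>) and \<open>x + z = 1\<close> for the last two (\<open>x = -s\<close>,
  \<open>z = s + 1\<close>), so that these two pairs impose nothing on the corners. For the four mixed pairs both
  diagonal products vanish and \<open>x + z\<close> may be \<open>s + t\<close> or \<open>s - t\<close>. If all four congruences
  are taken modulo \<open>s + t\<close>, they imply \<open>4 t\<^sup>2 r = 0\<close> modulo \<open>s + t\<close>, which may be false. If the last
  one is taken modulo \<open>s - t\<close> instead, only the common divisors of \<open>s + t\<close> and \<open>s - t\<close> can obstruct
  a solution; they divide \<open>2 t\<close>, so the obstruction disappears, and there is a solution
  for every \<open>\<beta>\<close> (\<open>mixed_pair_equations\<close>).

  It remains to keep the matrices distinct and nonzero. If \<open>s \<noteq> t\<close>, then \<open>\<beta>\<^sub>2\<close> and \<open>\<beta>\<^sub>4\<close> may be moved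
  by multiples of \<open>s\<^sup>2 - t\<^sup>2\<close>; if \<open>s = t > 0\<close>, the diagonals are already distinct; and if \<open>s = t = 0\<close>,
  the matrices \<open>(0, 2\<beta>; 1)\<close> satisfy the condition pairwise, since then \<open>x + z = 1\<close>. As
  \<open>\<beta>\<close> is arbitrary, infinitely many matrices occur in quadruples, and hence there are
  infinitely many quadruples.
\<close>

section \<open>Pairs of upper triangular matrices\<close>

definition ut :: "int \<Rightarrow> int \<Rightarrow> int \<Rightarrow> int ^ 2 ^ 2" where
  "ut a b c = vector [vector [a, b], vector [0, c]]"

lemma ut_nth [simp]:
  "ut a b c $ 1 $ 1 = a" "ut a b c $ 1 $ 2 = b" "ut a b c $ 2 $ 1 = 0" "ut a b c $ 2 $ 2 = c"
  by (simp_all add: ut_def)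

lemma ut_eq_iff [simp]: "ut a b c = ut a' b' c' \<longleftrightarrow> a = a' \<and> b = b' \<and> c = c'"
  by (auto simp: vec_eq_iff forall_2)

lemma ut_eq_0_iff [simp]: "ut a b c = 0 \<longleftrightarrow> a = 0 \<and> b = 0 \<and> c = 0"
  by (auto simp: vec_eq_iff forall_2)

lemma ut_in_UT2 [simp]: "ut a b c \<in> UT2"
  by (simp add: UT2_def)

definition jordan_compatible :: "int ^ 2 ^ 2 \<Rightarrow> int ^ 2 ^ 2 \<Rightarrow> int ^ 2 ^ 2 \<Rightarrow> bool" where
  "jordan_compatible N A B \<longleftrightarrow>
     (\<exists>X\<in>UT2. jordan_product (rat_matrix A) (rat_matrix B) + rat_matrix N = rat_matrix (X ** X))"

lemma jordan_compatible_commute: "jordan_compatible N A B \<longleftrightarrow> jordan_compatible N B A"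
  by (simp add: jordan_compatible_def jordan_product_def add.commute)

lemma jordan_compatible_utI:
  assumes "a * a' + m = x\<^sup>2" and "c * c' + n = z\<^sup>2"
    and "(a + c) * \<beta>' + (a' + c') * \<beta> + r = y * (x + z)"
  shows "jordan_compatible (ut m r n) (ut a (2 * \<beta>) c) (ut a' (2 * \<beta>') c')"
proof -
  have rat: "rat_of_int a * rat_of_int a' + rat_of_int m = rat_of_int x * rat_of_int x"
    "rat_of_int c * rat_of_int c' + rat_of_int n = rat_of_int z * rat_of_int z"
    "(rat_of_int a + rat_of_int c) * rat_of_int \<beta>' + (rat_of_int a' + rat_of_int c') * rat_of_int \<beta>
       + rat_of_int r = rat_of_int y * (rat_of_int x + rat_of_int z)"
    using assms[THEN arg_cong[where f = rat_of_int]] by (simp_all add: power2_eq_square)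
  have "jordan_product (rat_matrix (ut a (2 * \<beta>) c)) (rat_matrix (ut a' (2 * \<beta>') c'))
          + rat_matrix (ut m r n) = rat_matrix (ut x y z ** ut x y z)"
    using rat by (simp add: vec_eq_iff forall_2 jordan_product_def rat_matrix_def
        matrix_matrix_mult_def sum_2 algebra_simps)
  then show ?thesis
    unfolding jordan_compatible_def by (intro bexI[of _ "ut x y z"]) simp_all
qed

lemma jordan_D_quadrupleI:
  assumes "{A, B, C, D} \<subseteq> UT2" "0 \<notin> {A, B, C, D}" "distinct [A, B, C, D]"
    and "jordan_compatible N A B" "jordan_compatible N A C" "jordan_compatible N A D"
      "jordan_compatible N B C" "jordan_compatible N B D" "jordan_compatible N C D"
  shows "jordan_D_quadruple N {A, B, C, D}"
proof -
  have "card {A, B, C, D} = 4"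
    using assms(3) by simp
  moreover have "\<forall>P\<in>{A, B, C, D}. \<forall>Q\<in>{A, B, C, D}. P \<noteq> Q \<longrightarrow> jordan_compatible N P Q"
    using assms(4-9) jordan_compatible_commute[of N] by simp
  ultimately show ?thesis
    using assms(1,2) unfolding jordan_D_quadruple_def jordan_compatible_def by blast
qed

section \<open>Solving for the corners\<close>

text \<open>
  The equation gives \<open>\<beta>\<^sub>3\<close>, and the first two divisibilities then fix \<open>\<beta>\<^sub>2\<close> and \<open>\<beta>\<^sub>4\<close> modulo \<open>s + t\<close>. If
  both are moved by \<open>k * (s + t)\<close> from \<open>- r + q * (r + \<beta>)\<close> and \<open>- r - v * \<beta>\<close>, then
  \<open>q * \<beta>\<^sub>4 + v * \<beta>\<^sub>2 + r\<close> becomes \<open>r * (q - 1) * (v - 1) + k * (s + t) * (q + v)\<close>. Modulo \<open>s - t\<close> one has \<open>q = 1 - 2 * t\<close>,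
  \<open>v = 1 + 2 * t\<close> and \<open>s + t = 2 * t\<close>, so this is \<open>-4 * t\<^sup>2 * r + 4 * t * k\<close>, which vanishes for
  \<open>k = t * r\<close>. Multiples of \<open>(s + t) * (s - t)\<close> respect both moduli.
\<close>

lemma mixed_pair_equations:
  fixes s t r \<beta> w w' :: int
  defines "q \<equiv> (t - 1)\<^sup>2 - s\<^sup>2" and "v \<equiv> (s + 1)\<^sup>2 - t\<^sup>2"
  defines "\<beta>\<^sub>2 \<equiv> - r + q * (r + \<beta>) + (s + t) * t * r + (s\<^sup>2 - t\<^sup>2) * w"
    and "\<beta>\<^sub>3 \<equiv> - r - \<beta>"
    and "\<beta>\<^sub>4 \<equiv> - r - v * \<beta> + (s + t) * t * r + (s\<^sup>2 - t\<^sup>2) * w'"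
  shows "\<beta>\<^sub>3 + \<beta> + r = 0"
    and "(s + t) dvd \<beta>\<^sub>4 + v * \<beta> + r"
    and "(s + t) dvd q * \<beta>\<^sub>3 + \<beta>\<^sub>2 + r"
    and "(s - t) dvd q * \<beta>\<^sub>4 + v * \<beta>\<^sub>2 + r"
proof -
  show "\<beta>\<^sub>3 + \<beta> + r = 0"
    by (simp add: \<beta>\<^sub>3_def)
  have "\<beta>\<^sub>4 + v * \<beta> + r = (s + t) * (t * r + (s - t) * w')"
    unfolding \<beta>\<^sub>4_def by (simp add: algebra_simps power2_eq_square)
  then show "(s + t) dvd \<beta>\<^sub>4 + v * \<beta> + r"
    by simp
  have "q * \<beta>\<^sub>3 + \<beta>\<^sub>2 + r = (s + t) * (t * r + (s - t) * w)"
    unfolding \<beta>\<^sub>2_def \<beta>\<^sub>3_def by (simp add: algebra_simps power2_eq_square)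
  then show "(s + t) dvd q * \<beta>\<^sub>3 + \<beta>\<^sub>2 + r"
    by simp
  have q: "q - 1 = - 2 * t - (s + t) * (s - t)" and v: "v - 1 = 2 * t + (s - t) * (s + t + 2)"
    unfolding q_def v_def by (simp_all add: algebra_simps power2_eq_square)
  have qv: "q + v = 2 + 2 * (s - t)"
    unfolding q_def v_def by (simp add: algebra_simps power2_eq_square)
  have "q * \<beta>\<^sub>4 + v * \<beta>\<^sub>2 + r
      = r * ((q - 1) * (v - 1) + (s + t) * t * (q + v)) + (s - t) * ((s + t) * (q * w' + v * w))"
    unfolding \<beta>\<^sub>2_def \<beta>\<^sub>4_def by (simp add: algebra_simps power2_eq_square)
  also have "(q - 1) * (v - 1) + (s + t) * t * (q + v)
      = (s - t) * (2 * t - 2 * t * (s + t + 2) - (s + t) * (2 * t + (s - t) * (s + t + 2))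
                   + 2 * t * (s + t))"
    unfolding q v qv by (simp add: algebra_simps)
  finally show "(s - t) dvd q * \<beta>\<^sub>4 + v * \<beta>\<^sub>2 + r"
    by (simp add: dvd_add)
qed

lemma progression_avoids_finite_set:
  fixes c d :: int
  assumes "d \<noteq> 0" and "finite F"
  obtains w where "c + d * w \<notin> F"
proof -
  have "inj (\<lambda>w. c + d * w)"
    using assms(1) by (auto intro: injI)
  then have "infinite (range (\<lambda>w. c + d * w))"
    using finite_imageD infinite_UNIV_int by blast
  then have "\<not> range (\<lambda>w. c + d * w) \<subseteq> F"
    using assms(2) finite_subset by blast
  then show thesis
    using that by blast
qed

section \<open>The quadruples\<close>

lemma quadruple_through_idempotent:
  fixes s t r \<beta> :: int
  assumes "s \<ge> 0" "t \<ge> 0" "(s, t) \<noteq> (0, 0)"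
  obtains S where "jordan_D_quadruple (ut (s\<^sup>2) r (t\<^sup>2)) S" "ut 1 (2 * \<beta>) 0 \<in> S"
proof -
  define q v where "q = (t - 1)\<^sup>2 - s\<^sup>2" and "v = (s + 1)\<^sup>2 - t\<^sup>2"
  define \<beta>\<^sub>2 \<beta>\<^sub>4
    where "\<beta>\<^sub>2 w = - r + q * (r + \<beta>) + (s + t) * t * r + (s\<^sup>2 - t\<^sup>2) * w"
      and "\<beta>\<^sub>4 w = - r - v * \<beta> + (s + t) * t * r + (s\<^sup>2 - t\<^sup>2) * w" for w
  define \<beta>\<^sub>3 where "\<beta>\<^sub>3 = - r - \<beta>"
  obtain w w' where dist: "(q, \<beta>\<^sub>2 w) \<noteq> (1, \<beta>)" "(q, \<beta>\<^sub>2 w) \<noteq> (0, 0)"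
    "(v, \<beta>\<^sub>4 w') \<noteq> (1, \<beta>\<^sub>3)" "(v, \<beta>\<^sub>4 w') \<noteq> (0, 0)" "(q, v, \<beta>\<^sub>2 w) \<noteq> (0, 0, \<beta>\<^sub>4 w')"
  proof (cases "s = t")
    case True
    then have "q = 1 - 2 * t" "v = 1 + 2 * t"
      by (simp_all add: q_def v_def power2_eq_square algebra_simps)
    with True assms(2,3) have "q \<notin> {0, 1}" "v \<notin> {0, 1}"
      by auto
    then show thesis
      using that[of 0 0] by blast
  next
    case False
    with assms(1,2) have nz: "s\<^sup>2 - t\<^sup>2 \<noteq> 0"
      by simp
    obtain w where "\<beta>\<^sub>2 w \<notin> {\<beta>, 0}"
      using progression_avoids_finite_set[OF nz, of "{\<beta>, 0}"] unfolding \<beta>\<^sub>2_def by blast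
    moreover obtain w' where "\<beta>\<^sub>4 w' \<notin> {\<beta>\<^sub>3, 0, \<beta>\<^sub>2 w}"
      using progression_avoids_finite_set[OF nz, of "{\<beta>\<^sub>3, 0, \<beta>\<^sub>2 w}"] unfolding \<beta>\<^sub>4_def by blast
    ultimately show thesis
      using that[of w w'] by auto
  qed
  obtain y\<^sub>1\<^sub>4 where y\<^sub>1\<^sub>4: "\<beta>\<^sub>4 w' + v * \<beta> + r = y\<^sub>1\<^sub>4 * (s + t)"
    using mixed_pair_equations(2)[where s = s and t = t and r = r and \<beta> = \<beta> and w' = w']
    unfolding \<beta>\<^sub>4_def v_def by (metis dvdE mult.commute)
  obtain y\<^sub>2\<^sub>3 where y\<^sub>2\<^sub>3: "q * \<beta>\<^sub>3 + \<beta>\<^sub>2 w + r = y\<^sub>2\<^sub>3 * (s + t)"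
    using mixed_pair_equations(3)[where s = s and t = t and r = r and \<beta> = \<beta> and w = w]
    unfolding \<beta>\<^sub>2_def \<beta>\<^sub>3_def q_def by (metis dvdE mult.commute)
  obtain y\<^sub>2\<^sub>4 where y\<^sub>2\<^sub>4: "q * \<beta>\<^sub>4 w' + v * \<beta>\<^sub>2 w + r = y\<^sub>2\<^sub>4 * (s - t)"
    using mixed_pair_equations(4)[where s = s and t = t and r = r and \<beta> = \<beta> and w = w and w' = w']
    unfolding \<beta>\<^sub>2_def \<beta>\<^sub>4_def q_def v_def by (metis dvdE mult.commute)
  let ?N = "ut (s\<^sup>2) r (t\<^sup>2)"
  let ?A = "ut 1 (2 * \<beta>) 0" and ?B = "ut q (2 * \<beta>\<^sub>2 w) 0"
    and ?C = "ut 0 (2 * \<beta>\<^sub>3) 1" and ?D = "ut 0 (2 * \<beta>\<^sub>4 w') v"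
  have "jordan_D_quadruple ?N {?A, ?B, ?C, ?D}"
  proof (rule jordan_D_quadrupleI)
    show "{?A, ?B, ?C, ?D} \<subseteq> UT2"
      by simp
    show "0 \<notin> {?A, ?B, ?C, ?D}" "distinct [?A, ?B, ?C, ?D]"
      using dist by auto
    show "jordan_compatible ?N ?A ?B"
      by (rule jordan_compatible_utI[where x = "t - 1" and z = "- t"
            and y = "- (\<beta>\<^sub>2 w + q * \<beta> + r)"]) (simp_all add: q_def)
    show "jordan_compatible ?N ?C ?D"
      by (rule jordan_compatible_utI[where x = "- s" and z = "s + 1"
            and y = "\<beta>\<^sub>4 w' + v * \<beta>\<^sub>3 + r"]) (simp_all add: v_def)
    show "jordan_compatible ?N ?A ?C"
      by (rule jordan_compatible_utI[where x = s and z = t and y = 0]) (simp_all add: \<beta>\<^sub>3_def)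
    show "jordan_compatible ?N ?A ?D"
      using y\<^sub>1\<^sub>4 by (intro jordan_compatible_utI[where x = s and z = t and y = y\<^sub>1\<^sub>4]) simp_all
    show "jordan_compatible ?N ?B ?C"
      using y\<^sub>2\<^sub>3 by (intro jordan_compatible_utI[where x = s and z = t and y = y\<^sub>2\<^sub>3]) simp_all
    show "jordan_compatible ?N ?B ?D"
      using y\<^sub>2\<^sub>4 by (intro jordan_compatible_utI[where x = s and z = "- t" and y = y\<^sub>2\<^sub>4]) simp_all
  qed
  then show thesis
    using that by blast
qed

lemma quadruple_nilpotent_case:
  "jordan_D_quadruple (ut 0 r 0)
     {ut 0 (2 * \<beta>) 1, ut 0 (2 * (\<beta> + 1)) 1, ut 0 (2 * (\<beta> + 2)) 1, ut 0 (2 * (\<beta> + 3)) 1}"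
proof -
  have "jordan_compatible (ut 0 r 0) (ut 0 (2 * \<gamma>) 1) (ut 0 (2 * \<delta>) 1)" for \<gamma> \<delta>
    by (rule jordan_compatible_utI[where x = 0 and z = 1 and y = "\<delta> + \<gamma> + r"]) simp_all
  then show ?thesis
    by (intro jordan_D_quadrupleI) (simp_all del: distrib_left_numeral)
qed

text \<open>
  Quadruples are finite, so finitely many of them contain only finitely many matrices. This spares
  a proof that different values of the parameter give different sets.
\<close>

lemma infinite_jordan_D_quadruplesI:
  fixes f :: "int \<Rightarrow> int ^ 2 ^ 2"
  assumes "inj f" and "\<And>\<beta>. \<exists>S. jordan_D_quadruple N S \<and> f \<beta> \<in> S"
  shows "infinite {S. jordan_D_quadruple N S}"
proof
  assume fin: "finite {S. jordan_D_quadruple N S}"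
  have "finite S" if "jordan_D_quadruple N S" for S
    using that by (intro card_ge_0_finite) (simp add: jordan_D_quadruple_def)
  with fin have "finite (\<Union>{S. jordan_D_quadruple N S})"
    by blast
  moreover have "range f \<subseteq> \<Union>{S. jordan_D_quadruple N S}"
    using assms(2) by blast
  ultimately have "finite (range f)"
    by (rule rev_finite_subset)
  with assms(1) show False
    using finite_imageD infinite_UNIV_int by blast
qed

theorem proposition14:
  fixes s t r :: int and N :: "int ^ 2 ^ 2"
  assumes "s \<ge> 0" and "t \<ge> 0"
    and "N = vector [vector [s\<^sup>2, r], vector [0, t\<^sup>2]]"
  shows "infinite {S. jordan_D_quadruple N S}"
proof -
  have N: "N = ut (s\<^sup>2) r (t\<^sup>2)"
    using assms(3) by (simp add: ut_def)
  show ?thesis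
  proof (cases "(s, t) = (0, 0)")
    case True
    then have "N = ut 0 r 0"
      using N by simp
    then have "\<exists>S. jordan_D_quadruple N S \<and> ut 0 (2 * \<beta>) 1 \<in> S" for \<beta>
      using quadruple_nilpotent_case by blast
    then show ?thesis
      by (intro infinite_jordan_D_quadruplesI[of "\<lambda>\<beta>. ut 0 (2 * \<beta>) 1"]) (simp_all add: inj_def)
  next
    case False
    have "\<exists>S. jordan_D_quadruple N S \<and> ut 1 (2 * \<beta>) 0 \<in> S" for \<beta>
      using quadruple_through_idempotent[OF assms(1,2) False] N by metis
    then show ?thesis
      by (intro infinite_jordan_D_quadruplesI[of "\<lambda>\<beta>. ut 1 (2 * \<beta>) 0"]) (simp_all add: inj_def)
  qed
qed

end
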